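(* Let $c$ and $k$ be nonnegative integers with $c \le k$. Let $R_2(c,k)$ denote the two-color off-diagonal Rado number of the pair of equations $x+y+c=z$ (red) and $x+y+k=z$ (blue), i.e. the smallest positive integer $N$ such that every red--blue coloring of $\{1,2,\dots,N\}$ contains either a red solution to $x+y+c=z$ or a blue solution to $x+y+k=z$ (and $R_2(c,k)=\infty$ if no such $N$ exists). Then \[ R_2(c,k) = \begin{cases} \infty, & \text{if } c \not\equiv k \pmod 2,\\ k+3c+5, & \text{if } c \equiv k \pmod 2 \text{ and } k \le 2c,\\ 2k+c+4, & \text{if } c \equiv k \pmod 2 \text{ and } k > 2c. \end{cases} \]
   Context: A red--blue coloring of a set $S$ is an arbitrary function $S \to \{\text{red},\text{blue}\}$. Given a red--blue coloring of $\{1,2,\dots,N\}$, a red solution to $x+y+c=z$ is a triple $(x,y,z)$ of elements of $\{1,2,\dots,N\}$, all colored red, with $x+y+c=z$; a blue solution to $x+y+k=z$ is a triple $(x,y,z)$ of elements of $\{1,2,\dots,N\}$, all colored blue, with $x+y+k=z$. The values $x,y,z$ are not required to be distinct (in particular $x=y$ is allowed). *)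

theory Defs
  imports Main "HOL-Library.Extended_Nat"
begin

datatype colour = Red | Blue

definition has_mono_solution :: "(nat \<Rightarrow> colour) \<Rightarrow> nat \<Rightarrow> colour \<Rightarrow> nat \<Rightarrow> bool" where
  "has_mono_solution f N q a \<longleftrightarrow>
     (\<exists>x\<in>{1..N}. \<exists>y\<in>{1..N}. \<exists>z\<in>{1..N}. f x = q \<and> f y = q \<and> f z = q \<and> x + y + a = z)"

text \<open>Colourings are total functions on the naturals; only their values on \<open>{1..N}\<close> matter,
  and every colouring of \<open>{1..N}\<close> extends to such a function.\<close>

definition rado_forcing :: "nat \<Rightarrow> nat \<Rightarrow> nat \<Rightarrow> bool" where
  "rado_forcing c k N \<longleftrightarrow>
     (\<forall>f :: nat \<Rightarrow> colour. has_mono_solution f N Red c \<or> has_mono_solution f N Blue k)"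

definition R\<^sub>2 :: "nat \<Rightarrow> nat \<Rightarrow> enat" where
  "R\<^sub>2 c k =
     (if \<exists>N\<ge>1. rado_forcing c k N then enat (LEAST N. 1 \<le> N \<and> rado_forcing c k N) else \<infinity>)"

end

theory Submission imports Defs begin

text \<open>
  If \<open>c\<close> and \<open>k\<close> have different parity, colouring by parity avoids both equations for every
  \<open>N\<close>: with \<open>c\<close> even and \<open>k\<close> odd, say, the sum of two odd numbers and \<open>c\<close> is never odd, and the
  sum of two even numbers and \<open>k\<close> is never even.

  If the parities agree, write \<open>k = c + 2 * d\<close>. The case distinction at \<open>k = 2 * c\<close> selects the
  maximum of \<open>k + 3 * c + 5\<close> and \<open>2 * k + c + 4\<close>. Each expression is a lower bound by
  an interval colouring. In one colour, take the longest initial interval free of solutions; give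
  the other colour to the next numbers, as long as this creates no solution; for
  \<open>k + 3 * c + 5\<close>, return to the first colour after that (lemmas \<open>red_blue_red_colouring\<close> and \<open>blue_red_colouring\<close>).

  For the upper bound, let \<open>N\<close> be at least both expressions and suppose a colouring of
  \<open>{1..N}\<close> avoids both equations. The colour of \<open>1\<close> then forces a chain of further colours.
  Two numbers of one colour force the other colour on the number that completes them to a
  solution, be it the sum or a summand, and a single number does so on the summand of which it is
  the shifted double. Equal parity makes the halving in
  \<open>2 * (c + d + 2) + c = k + 2 * c + 4\<close> and \<open>2 * (c + d + 2) + k = 2 * k + c + 4\<close> possible, and
  the number \<open>c + d + 2\<close> obtained this way carries both chains (lemmas \<open>one_not_red\<close> and
  \<open>one_not_blue\<close>) to a contradiction.
\<close>

section \<open>Monochromatic solutions\<close>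

lemma has_mono_solution_mono:
  "has_mono_solution f M q a \<Longrightarrow> M \<le> N \<Longrightarrow> has_mono_solution f N q a"
  unfolding has_mono_solution_def by fastforce

lemma other_colour [simp]: "q \<noteq> Red \<longleftrightarrow> q = Blue" "q \<noteq> Blue \<longleftrightarrow> q = Red"
  by (cases q; simp)+

text \<open>The equation is a separate premise with \<open>z\<close> free, so that the rule forces the colour of
  either a sum or a summand, according to which of the three colours is taken as conclusion.\<close>

lemma no_mono_solutionD:
  assumes "\<not> has_mono_solution f N q a"
    and "x + y + a = z" "1 \<le> x" "1 \<le> y" "z \<le> N"
  shows "f x \<noteq> q \<or> f y \<noteq> q \<or> f z \<noteq> q"
proof -
  have "x \<in> {1..N}" "y \<in> {1..N}" "z \<in> {1..N}"
    using assms(2-5) by auto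
  then show ?thesis
    using assms(1,2) unfolding has_mono_solution_def by blast
qed

section \<open>Colourings without solutions\<close>

lemma parity_colouring:
  assumes "c mod 2 \<noteq> k mod 2"
  shows "\<not> rado_forcing c k N"
proof -
  define f where "f n = (if even (n + c) then Blue else Red)" for n
  have "\<not> has_mono_solution f N Red c" "\<not> has_mono_solution f N Blue k"
    using assms unfolding has_mono_solution_def f_def by (auto simp: mod2_eq_if split: if_splits)
  then show ?thesis
    unfolding rado_forcing_def by blast
qed

text \<open>Two summands from the first red interval give a \<open>z\<close> between \<open>c + 2\<close> and
  \<open>3 * c + 2\<close>, which is blue because \<open>c \<le> k\<close>; a summand from the second one gives a \<open>z\<close> of at
  least \<open>k + 3 * c + 5\<close>, out of range. Blue summands give a \<open>z\<close> of at least \<open>2 * c + k + 4\<close>, where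
  the second red interval begins.\<close>

lemma red_blue_red_colouring:
  assumes "c \<le> k"
  shows "\<not> rado_forcing c k (k + 3 * c + 4)"
proof -
  define f where "f n = (if n < c + 2 \<or> 2 * c + k + 4 \<le> n then Red else Blue)" for n
  have "\<not> has_mono_solution f (k + 3 * c + 4) Red c"
    "\<not> has_mono_solution f (k + 3 * c + 4) Blue k"
    using assms unfolding has_mono_solution_def f_def by (auto split: if_splits)
  then show ?thesis
    unfolding rado_forcing_def by blast
qed

lemma blue_red_colouring: "\<not> rado_forcing c k (2 * k + c + 3)"
proof -
  define f where "f n = (if n < k + 2 then Blue else Red)" for n
  have "\<not> has_mono_solution f (2 * k + c + 3) Red c"
    "\<not> has_mono_solution f (2 * k + c + 3) Blue k"
    unfolding has_mono_solution_def f_def by (auto split: if_splits)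
  then show ?thesis
    unfolding rado_forcing_def by blast
qed

section \<open>Forcing\<close>

text \<open>Red \<open>1\<close> turns red at \<open>x\<close> into blue at \<open>x + 1 + c\<close> and, downwards, at \<open>x - 1 - c\<close>. With this
  the chain arrives at the red triple \<open>2 * d + 1\<close>, \<open>2 * c + 3\<close>, \<open>k + 2 * c + 4\<close>.\<close>

lemma one_not_red:
  assumes k: "k = c + 2 * d"
    and N: "k + 3 * c + 5 \<le> N" "2 * k + c + 4 \<le> N"
    and red: "\<not> has_mono_solution f N Red c" and blue: "\<not> has_mono_solution f N Blue k"
  shows "f 1 \<noteq> Red"
proof
  assume 1: "f 1 = Red"
  have a: "f (c + 2) = Blue"
    using no_mono_solutionD[OF red, of 1 1 "c + 2"] 1 N by simp
  have b: "f (k + 2 * c + 4) = Red"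
    using no_mono_solutionD[OF blue, of "c + 2" "c + 2" "k + 2 * c + 4"] a N by simp
  have "f (k + 3 * c + 5) = Blue"
    using no_mono_solutionD[OF red, of 1 "k + 2 * c + 4" "k + 3 * c + 5"] 1 b N by simp
  then have e: "f (2 * c + 3) = Red"
    using no_mono_solutionD[OF blue, of "c + 2" "2 * c + 3" "k + 3 * c + 5"] a N by simp
  have "f (c + d + 2) = Blue"
    using no_mono_solutionD[OF red, of "c + d + 2" "c + d + 2" "k + 2 * c + 4"] b N k by simp
  then have "f (2 * k + c + 4) = Red"
    using no_mono_solutionD[OF blue, of "c + d + 2" "c + d + 2" "2 * k + c + 4"] N k by simp
  then have "f (2 * k + 3) = Blue"
    using no_mono_solutionD[OF red, of "2 * k + 3" 1 "2 * k + c + 4"] 1 N by simp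
  then have "f (2 * d + 1) = Red"
    using no_mono_solutionD[OF blue, of "c + 2" "2 * d + 1" "2 * k + 3"] a N k by simp
  then show False
    using no_mono_solutionD[OF red, of "2 * d + 1" "2 * c + 3" "k + 2 * c + 4"] e b N k by simp
qed

text \<open>The chain ends at the red triple \<open>c + 2\<close>, \<open>c + 2\<close>, \<open>3 * c + 4\<close>. Its largest member turns red
  for different reasons on the two sides of \<open>k = 2 * c\<close>: it is the summand missing from \<open>1\<close> in
  \<open>k + 3 * c + 5\<close>, or the one missing from \<open>k - 2 * c\<close> in \<open>2 * k + c + 4\<close>. The
  second reason needs \<open>k - 2 * c\<close> to be positive.\<close>

lemma one_not_blue:
  assumes k: "k = c + 2 * d"
    and N: "k + 3 * c + 5 \<le> N" "2 * k + c + 4 \<le> N"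
    and red: "\<not> has_mono_solution f N Red c" and blue: "\<not> has_mono_solution f N Blue k"
  shows "f 1 \<noteq> Blue"
proof
  assume 1: "f 1 = Blue"
  have a: "f (k + 2) = Red"
    using no_mono_solutionD[OF blue, of 1 1 "k + 2"] 1 N by simp
  have b: "f (2 * k + c + 4) = Blue"
    using no_mono_solutionD[OF red, of "k + 2" "k + 2" "2 * k + c + 4"] a N by simp
  have e: "f (k + c + 3) = Red"
    using no_mono_solutionD[OF blue, of 1 "k + c + 3" "2 * k + c + 4"] 1 b N by simp
  have "f (c + d + 2) = Red"
    using no_mono_solutionD[OF blue, of "c + d + 2" "c + d + 2" "2 * k + c + 4"] b N k by simp
  then have g: "f (k + 2 * c + 4) = Blue"
    using no_mono_solutionD[OF red, of "c + d + 2" "c + d + 2" "k + 2 * c + 4"] N k by simp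
  have h: "f (c + 2) = Red"
    using no_mono_solutionD[OF blue, of "c + 2" "c + 2" "k + 2 * c + 4"] g N by simp
  have i: "f (2 * c + 3) = Red"
    using no_mono_solutionD[OF blue, of 1 "2 * c + 3" "k + 2 * c + 4"] 1 g N by simp
  have "f (3 * c + 4) = Red"
  proof (cases "k \<le> 2 * c")
    case True
    have "f (k + 3 * c + 5) = Blue"
      using no_mono_solutionD[OF red, of "2 * c + 3" "k + 2" "k + 3 * c + 5"] a i N by simp
    then show ?thesis
      using no_mono_solutionD[OF blue, of 1 "3 * c + 4" "k + 3 * c + 5"] 1 N by simp
  next
    case False
    have "f (k - 2 * c) = Blue"
      using no_mono_solutionD[OF red, of "k - 2 * c" "2 * c + 3" "k + c + 3"] e i N False by simp
    then show ?thesis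
      using no_mono_solutionD[OF blue, of "k - 2 * c" "3 * c + 4" "2 * k + c + 4"] b N False by simp
  qed
  then show False
    using no_mono_solutionD[OF red, of "c + 2" "c + 2" "3 * c + 4"] h N by simp
qed

lemma rado_forcing_if_even_difference:
  assumes "k = c + 2 * d" "k + 3 * c + 5 \<le> N" "2 * k + c + 4 \<le> N"
  shows "rado_forcing c k N"
  unfolding rado_forcing_def using one_not_red[OF assms] one_not_blue[OF assms] by fastforce

section \<open>The Rado numbers\<close>

lemma R\<^sub>2_eq_SucI:
  assumes "rado_forcing c k (Suc M)" "\<not> rado_forcing c k M"
  shows "R\<^sub>2 c k = enat (Suc M)"
proof -
  have "(LEAST N. 1 \<le> N \<and> rado_forcing c k N) = Suc M"
  proof (rule Least_equality)
    show "1 \<le> Suc M \<and> rado_forcing c k (Suc M)"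
      using assms(1) by simp
  next
    fix N
    assume N: "1 \<le> N \<and> rado_forcing c k N"
    show "Suc M \<le> N"
    proof (rule ccontr)
      assume "\<not> Suc M \<le> N"
      then have "N \<le> M"
        by simp
      then have "rado_forcing c k M"
        using N has_mono_solution_mono unfolding rado_forcing_def by blast
      then show False
        using assms(2) by blast
    qed
  qed
  moreover have "\<exists>N\<ge>1. rado_forcing c k N"
    using assms(1) by (intro exI[of _ "Suc M"]) simp
  ultimately show ?thesis
    unfolding R\<^sub>2_def by simp
qed

theorem theorem1:
  fixes c k :: nat
  assumes "c \<le> k"
  shows "R\<^sub>2 c k =
    (if c mod 2 \<noteq> k mod 2 then \<infinity>
     else if k \<le> 2 * c then enat (k + 3 * c + 5)
     else enat (2 * k + c + 4))"
proof (cases "c mod 2 = k mod 2")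
  case False
  then show ?thesis
    using parity_colouring unfolding R\<^sub>2_def by simp
next
  case True
  have "even (k - c)"
    using True by (auto simp: mod2_eq_if split: if_splits)
  then obtain d where d: "k = c + 2 * d"
    using assms by (metis dvdE le_add_diff_inverse)
  show ?thesis
  proof (cases "k \<le> 2 * c")
    case le: True
    have "R\<^sub>2 c k = enat (Suc (k + 3 * c + 4))"
      using rado_forcing_if_even_difference[OF d] red_blue_red_colouring[OF assms] le
      by (intro R\<^sub>2_eq_SucI) simp_all
    then show ?thesis
      using True le by (simp add: eval_nat_numeral)
  next
    case gt: False
    have "R\<^sub>2 c k = enat (Suc (2 * k + c + 3))"
      using rado_forcing_if_even_difference[OF d] blue_red_colouring gt
      by (intro R\<^sub>2_eq_SucI) simp_all
    then show ?thesis
      using True gt by (simp add: eval_nat_numeral)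
  qed
qed

end
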